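(* Let $\Lambda=\{1,\dots,N\}$, $n=\sum_{i\in\Lambda}n_i$, let $\mathcal X\subseteq\mathbb R^n=\prod_{i\in\Lambda}\mathbb R^{n_i}$ be non-empty, let $X_i$ be the projection of $\mathcal X$ on $\mathbb R^{n_i}$, and let $X=\prod_{i\in\Lambda}X_i$. Suppose that for each $i\in\Lambda$ the multi-valued map $P_i:X\rightrightarrows X_i$ has open upper sections, and that $K_i:X\rightrightarrows X_i$ is given by $K_i(x)=\{z_i\in X_i\mid (x_{-i},z_i)\in\mathcal X\}$. For $x\in X$ set $T_i(x)=co\big(\mathcal N_{\tilde P_i}(x)\cap S_i[0,1]\big)$ and $T(x)=\prod_{i\in\Lambda}T_i(x)$. Then every solution of the variational inequality $VI(T,\mathcal X)$ is an equilibrium for the game $\Gamma'=(\mathcal X,K_i,P_i)_{i\in\Lambda}$.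
   Context: Notation: $x=(x_i)_{i\in\Lambda}=(x_{-i},x_i)$, where $x_{-i}$ collects the components of all players except $i$; $co(C)$ is the convex hull of $C$; values of multi-valued maps may be empty. Open upper sections: $P_i$ has open upper sections if $P_i(x)$ is open (as a subset of $\mathbb R^{n_i}$) for every $x\in X$. $\tilde P_i(x)=co(P_i(x))$, and $\mathcal N_{\tilde P_i}(x)=\{y^*\in\mathbb R^{n_i}\mid \langle y^*,z-x_i\rangle\le 0\ \ \forall z\in\tilde P_i(x)\}$, which equals $\mathbb R^{n_i}$ when $\tilde P_i(x)=\emptyset$. $S_i[0,1]=\{v\in\mathbb R^{n_i}\mid\|v\|=1\}$ is the unit sphere for the Euclidean norm. $VI(T,\mathcal X)$: a solution is a point $\bar x\in\mathcal X$ for which there exists $\bar x^*\in T(\bar x)$ with $\langle\bar x^*,z-\bar x\rangle\ge 0$ for all $z\in\mathcal X$. Equilibrium: $\tilde x\in X$ is an equilibrium for the game $\Gamma'$ if, for each $i\in\Lambda$, $\tilde x_i\in K_i(\tilde x)$ and $P_i(\tilde x)\cap K_i(\tilde x)=\emptyset$. (The game is called a jointly convex generalized Nash equilibrium problem when $\mathcal X$ is non-empty, closed and convex.) *)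

theory Defs
  imports "HOL-Analysis.Analysis"
begin

text \<open>
  Encoding of \<open>\<real>\<^sup>n = \<Prod>\<^sub>i \<real>\<^bsup>n\<^sub>i\<^esup>\<close> with player-dependent dimensions: the coordinates of
  \<open>\<real>\<^sup>n\<close> are the elements of a finite type \<open>'k\<close>, and \<open>b :: 'k \<Rightarrow> nat\<close> tells which player
  each coordinate belongs to. The factor of player \<open>i\<close> is the coordinate subspace
  \<open>block_space b i\<close> of vectors vanishing off the block \<open>b -` {i}\<close>, so its dimension is the
  size of that block. Linear structure, inner product, norm and convex hulls are those
  inherited from the whole space; the topology of a factor is the subspace topology.
\<close>

definition block_space :: "('k::finite \<Rightarrow> nat) \<Rightarrow> nat \<Rightarrow> (real ^ 'k) set" where
  "block_space b i = {v. \<forall>k. b k \<noteq> i \<longrightarrow> v $ k = 0}"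

definition component :: "('k::finite \<Rightarrow> nat) \<Rightarrow> nat \<Rightarrow> real ^ 'k \<Rightarrow> real ^ 'k" where
  "component b i x = (\<chi> k. if b k = i then x $ k else 0)"

text \<open>The profile \<open>(x\<^sub>-\<^sub>i, z)\<close>.\<close>

definition deviate :: "('k::finite \<Rightarrow> nat) \<Rightarrow> nat \<Rightarrow> real ^ 'k \<Rightarrow> real ^ 'k \<Rightarrow> real ^ 'k" where
  "deviate b i x z = (\<chi> k. if b k = i then z $ k else x $ k)"

definition block_prod ::
  "('k::finite \<Rightarrow> nat) \<Rightarrow> nat \<Rightarrow> (nat \<Rightarrow> (real ^ 'k) set) \<Rightarrow> (real ^ 'k) set" where
  "block_prod b N A = {x. \<forall>i\<in>{1..N}. component b i x \<in> A i}"

definition strategy_set :: "('k::finite \<Rightarrow> nat) \<Rightarrow> (real ^ 'k) set \<Rightarrow> nat \<Rightarrow> (real ^ 'k) set" where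
  "strategy_set b \<X> i = component b i ` \<X>"

definition profile_set :: "('k::finite \<Rightarrow> nat) \<Rightarrow> nat \<Rightarrow> (real ^ 'k) set \<Rightarrow> (real ^ 'k) set" where
  "profile_set b N \<X> = block_prod b N (strategy_set b \<X>)"

definition open_upper_sections ::
  "('k::finite \<Rightarrow> nat) \<Rightarrow> nat \<Rightarrow> (real ^ 'k) set \<Rightarrow> (real ^ 'k \<Rightarrow> (real ^ 'k) set) \<Rightarrow> bool" where
  "open_upper_sections b i X Q \<longleftrightarrow> (\<forall>x\<in>X. openin (top_of_set (block_space b i)) (Q x))"

definition normal_cone ::
  "('k::finite \<Rightarrow> nat) \<Rightarrow> nat \<Rightarrow> (real ^ 'k \<Rightarrow> (real ^ 'k) set) \<Rightarrow> real ^ 'k \<Rightarrow> (real ^ 'k) set" where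
  "normal_cone b i Q x = {y \<in> block_space b i. \<forall>z\<in>Q x. y \<bullet> (z - component b i x) \<le> 0}"

definition unit_normal_hull ::
  "('k::finite \<Rightarrow> nat) \<Rightarrow> nat \<Rightarrow> (real ^ 'k \<Rightarrow> (real ^ 'k) set) \<Rightarrow> real ^ 'k \<Rightarrow> (real ^ 'k) set" where
  "unit_normal_hull b i Q x =
     convex hull (normal_cone b i (\<lambda>x. convex hull (Q x)) x \<inter> {v \<in> block_space b i. norm v = 1})"

definition VI_solution :: "('a::real_inner \<Rightarrow> 'a set) \<Rightarrow> 'a set \<Rightarrow> 'a \<Rightarrow> bool" where
  "VI_solution T \<X> x \<longleftrightarrow> x \<in> \<X> \<and> (\<exists>y\<in>T x. \<forall>z\<in>\<X>. y \<bullet> (z - x) \<ge> 0)"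

definition equilibrium ::
  "('k::finite \<Rightarrow> nat) \<Rightarrow> nat \<Rightarrow> (real ^ 'k) set \<Rightarrow> (nat \<Rightarrow> real ^ 'k \<Rightarrow> (real ^ 'k) set) \<Rightarrow>
   (nat \<Rightarrow> real ^ 'k \<Rightarrow> (real ^ 'k) set) \<Rightarrow> real ^ 'k \<Rightarrow> bool" where
  "equilibrium b N \<X> K P x \<longleftrightarrow>
     x \<in> profile_set b N \<X> \<and>
     (\<forall>i\<in>{1..N}. component b i x \<in> K i x \<and> P i x \<inter> K i x = {})"

end

theory Submission
  imports Defs
begin

text \<open>
  A unit vector \<open>v\<close> that is normal to an open set strictly separates that set from \<open>x\<^sub>i\<close>, because
  any point \<open>z\<close> of the set can be pushed a little further along \<open>v\<close>. Strict negativity of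
  \<open>v \<bullet> (z - x\<^sub>i)\<close> is preserved by convex combinations of \<open>v\<close>, so it holds on all of \<open>T\<^sub>i(x)\<close>. A
  feasible profitable unilateral deviation \<open>z\<close> would therefore violate the variational inequality
  at the profile \<open>(x\<^sub>-\<^sub>i, z)\<close>.
\<close>

lemma block_space_add_scaleR:
  assumes "u \<in> block_space b i" "v \<in> block_space b i"
  shows "u + c *\<^sub>R v \<in> block_space b i"
  using assms by (simp add: block_space_def)

lemma deviate_component [simp]: "deviate b i x (component b i x) = x"
  by (simp add: deviate_def component_def vec_eq_iff)

text \<open>The two profiles agree off block \<open>i\<close>, so only that block contributes. This
  turns the variational inequality at a unilateral deviation into an inequality in the factor of
  player \<open>i\<close>.\<close>

lemma inner_deviate_diff:
  assumes "z \<in> block_space b i"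
  shows "y \<bullet> (deviate b i x z - x) = component b i y \<bullet> (z - component b i x)"
  using assms unfolding inner_vec_def
  by (intro sum.cong) (auto simp: deviate_def component_def block_space_def)

lemma subset_profile_set: "\<X> \<subseteq> profile_set b N \<X>"
  by (auto simp: profile_set_def block_prod_def strategy_set_def)

lemma unit_normal_inner_neg:
  assumes opn: "openin (top_of_set (block_space b i)) (Q x)"
    and z: "z \<in> Q x"
    and v: "v \<in> normal_cone b i Q x" "norm v = 1"
  shows "v \<bullet> (z - component b i x) < 0"
proof -
  obtain e where e: "e > 0" "ball z e \<inter> block_space b i \<subseteq> Q x"
    using opn z by (auto simp: openin_contains_ball)
  have vb: "v \<in> block_space b i"
    using v by (simp add: normal_cone_def)
  have zb: "z \<in> block_space b i"
    using opn z openin_imp_subset by blast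
  \<comment> \<open>As \<open>norm v = 1\<close>, the push has length \<open>e / 2\<close> and stays
    in the ball; it stays in the factor because \<open>v\<close> lies there, so relative openness
    suffices.\<close>
  have "z + (e / 2) *\<^sub>R v \<in> ball z e"
    using e v by (simp add: dist_norm)
  then have "z + (e / 2) *\<^sub>R v \<in> Q x"
    using e block_space_add_scaleR[OF zb vb] by blast
  then have "v \<bullet> (z + (e / 2) *\<^sub>R v - component b i x) \<le> 0"
    using v by (simp add: normal_cone_def)
  moreover have "v \<bullet> v = 1"
    using v by (simp add: dot_square_norm)
  ultimately show ?thesis
    using e by (simp add: inner_diff_right inner_add_right)
qed

lemma normal_cone_antimono: "Q x \<subseteq> R x \<Longrightarrow> normal_cone b i R x \<subseteq> normal_cone b i Q x"
  by (auto simp: normal_cone_def)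

text \<open>An open half-space is convex, so it contains the hull once it contains the unit normals.
  Strictness excludes 0, which a hull of opposite unit vectors would contain.\<close>

lemma unit_normal_hull_inner_neg:
  assumes opn: "openin (top_of_set (block_space b i)) (Q x)"
    and z: "z \<in> Q x"
    and y: "y \<in> unit_normal_hull b i Q x"
  shows "y \<bullet> (z - component b i x) < 0"
proof -
  let ?H = "{v. (z - component b i x) \<bullet> v < 0}"
  \<comment> \<open>Normals to the hull are normals to \<open>Q x\<close> itself, where the openness
    assumption applies directly.\<close>
  have "normal_cone b i (\<lambda>x. convex hull (Q x)) x \<subseteq> normal_cone b i Q x"
    by (intro normal_cone_antimono hull_subset)
  then have "unit_normal_hull b i Q x \<subseteq> ?H"
    unfolding unit_normal_hull_def using unit_normal_inner_neg[where Q = Q and x = x, OF opn z]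
    by (intro hull_minimal convex_halfspace_lt) (auto simp: inner_commute)
  then show ?thesis
    using y by (auto simp: inner_commute)
qed

theorem theorem3p1:
  fixes N :: nat
    and n :: "nat \<Rightarrow> nat"
    and b :: "'k::finite \<Rightarrow> nat"
    and \<X> X :: "(real ^ 'k) set"
    and Xi :: "nat \<Rightarrow> (real ^ 'k) set"
    and P K Ti :: "nat \<Rightarrow> real ^ 'k \<Rightarrow> (real ^ 'k) set"
    and T :: "real ^ 'k \<Rightarrow> (real ^ 'k) set"
    and x :: "real ^ 'k"
  assumes "\<And>k. b k \<in> {1..N}"
    and "\<And>i. i \<in> {1..N} \<Longrightarrow> card {k. b k = i} = n i"
    and "\<X> \<noteq> {}"
    and "\<And>i. i \<in> {1..N} \<Longrightarrow> Xi i = strategy_set b \<X> i"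
    and "X = profile_set b N \<X>"
    and "\<And>i x. i \<in> {1..N} \<Longrightarrow> x \<in> X \<Longrightarrow> P i x \<subseteq> Xi i"
    and "\<And>i. i \<in> {1..N} \<Longrightarrow> open_upper_sections b i X (P i)"
    and "\<And>i x. i \<in> {1..N} \<Longrightarrow> x \<in> X \<Longrightarrow> K i x = {z \<in> Xi i. deviate b i x z \<in> \<X>}"
    and "\<And>i x. i \<in> {1..N} \<Longrightarrow> x \<in> X \<Longrightarrow> Ti i x = unit_normal_hull b i (P i) x"
    and "\<And>x. x \<in> X \<Longrightarrow> T x = block_prod b N (\<lambda>i. Ti i x)"
    and "VI_solution T \<X> x"
  shows "equilibrium b N \<X> K P x"
proof -
  obtain y where x: "x \<in> \<X>" and y: "y \<in> T x" and vi: "\<And>z. z \<in> \<X> \<Longrightarrow> y \<bullet> (z - x) \<ge> 0"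
    using assms(11) by (auto simp: VI_solution_def)
  have xX: "x \<in> X"
    using x subset_profile_set assms(5) by blast
  \<comment> \<open>Not deviating is feasible: replacing the block of \<open>x\<close> by itself
    gives back \<open>x\<close>, a point of \<open>\<X>\<close>.\<close>
  have "component b i x \<in> K i x" if i: "i \<in> {1..N}" for i
    using x by (simp add: assms(8)[OF i xX] assms(4)[OF i] strategy_set_def)
  moreover have "P i x \<inter> K i x = {}" if i: "i \<in> {1..N}" for i
  proof (rule ccontr)
    assume "P i x \<inter> K i x \<noteq> {}"
    then obtain z where zP: "z \<in> P i x" and zX: "deviate b i x z \<in> \<X>"
      using assms(8)[OF i xX] by auto
    have opn: "openin (top_of_set (block_space b i)) (P i x)"
      using assms(7)[OF i] xX by (simp add: open_upper_sections_def)
    have "component b i y \<in> unit_normal_hull b i (P i) x"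
      using y i assms(9)[OF i xX] assms(10)[OF xX] by (auto simp: block_prod_def)
    from unit_normal_hull_inner_neg[where Q = "P i" and x = x, OF opn zP this]
    have "component b i y \<bullet> (z - component b i x) < 0" .
    \<comment> \<open>Relative openness places \<open>P i x\<close> inside the factor, as
      \<open>inner_deviate_diff\<close> requires.\<close>
    moreover have "z \<in> block_space b i"
      using opn zP openin_imp_subset by blast
    ultimately show False
      using vi[OF zX] by (simp add: inner_deviate_diff)
  qed
  ultimately show ?thesis
    using xX assms(5) by (simp add: equilibrium_def)
qed

end
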